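(* Let $\Gamma=a_1\Gamma_1+a_2\Gamma_2$ be a gluing of numerical semigroups. Then for every $z\in\mathbb{Z}$, $$\operatorname{Ap}(\Gamma,a_1z)=a_1\operatorname{Ap}(\Gamma_1,z)+a_2\operatorname{Ap}(\Gamma_2,a_1).$$ In particular $\#\operatorname{Ap}(\Gamma,a_1z)= a_1\cdot\#\operatorname{Ap}(\Gamma_1,z)$.
   Context: $\mathbb N$ denotes the non-negative integers. A numerical semigroup is a set $\langle n_1,\dots,n_m\rangle:=n_1\mathbb N+\cdots+n_m\mathbb N$ with $n_i$ positive integers and $\gcd(n_1,\dots,n_m)=1$. The minimal generators of $\Gamma$ are the elements of its unique minimal generating set. For $x\in\mathbb Z$, the Apéry set is $\operatorname{Ap}(\Gamma,x)=\{a\in\Gamma\mid a-x\notin\Gamma\}$. Gluing: given numerical semigroups $\Gamma_1,\Gamma_2$, $a_1\in\Gamma_2$ and $a_2\in\Gamma_1$ with $\gcd(a_1,a_2)=1$, $a_1$ not a minimal generator of $\Gamma_2$ and $a_2$ not a minimal generator of $\Gamma_1$, the numerical semigroup $a_1\Gamma_1+a_2\Gamma_2$ is called a gluing of $\Gamma_1$ and $\Gamma_2$. For sets of integers $X,Y$ and an integer $a$: $aX=\{ax\mid x\in X\}$ and $X+Y=\{x+y\mid x\in X,y\in Y\}$ (empty if either is empty). *)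

theory Defs
  imports "HOL-Library.Set_Algebras"
begin

text \<open>
  Semigroups are sets of integers. The elementwise sum \<open>X + Y\<close> and the dilation \<open>a *o X\<close>
  are those of \<open>HOL-Library.Set_Algebras\<close>.
\<close>

text \<open>Meaningful for finite \<open>A\<close> only; \<open>generates\<close> adds this restriction.\<close>

definition nat_span :: "int set \<Rightarrow> int set" where
  "nat_span A = {\<Sum>a\<in>A. int (c a) * a | c :: int \<Rightarrow> nat. True}"

definition generates :: "int set \<Rightarrow> int set \<Rightarrow> bool" where
  "generates A S \<longleftrightarrow> finite A \<and> (\<forall>a\<in>A. a > 0) \<and> nat_span A = S"

definition numerical_semigroup :: "int set \<Rightarrow> bool" where
  "numerical_semigroup S \<longleftrightarrow> (\<exists>A. generates A S \<and> Gcd A = 1)"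

definition minimal_generating_set :: "int set \<Rightarrow> int set \<Rightarrow> bool" where
  "minimal_generating_set A S \<longleftrightarrow> generates A S \<and> (\<forall>B. B \<subset> A \<longrightarrow> \<not> generates B S)"

text \<open>Well-defined by \<open>ex1_minimal_generating_set\<close> below.\<close>

definition minimal_generators :: "int set \<Rightarrow> int set" where
  "minimal_generators S = (THE A. minimal_generating_set A S)"

definition apery :: "int set \<Rightarrow> int \<Rightarrow> int set" where
  "apery S x = {a \<in> S. a - x \<notin> S}"

definition is_gluing :: "int set \<Rightarrow> int \<Rightarrow> int set \<Rightarrow> int \<Rightarrow> int set \<Rightarrow> bool" where
  "is_gluing S a1 S1 a2 S2 \<longleftrightarrow>
     numerical_semigroup S1 \<and> numerical_semigroup S2 \<and>
     a1 \<in> S2 \<and> a2 \<in> S1 \<and> gcd a1 a2 = 1 \<and>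
     a1 \<notin> minimal_generators S2 \<and> a2 \<notin> minimal_generators S1 \<and>
     S = a1 *o S1 + a2 *o S2"

lemma nat_spanI: "(\<Sum>a\<in>A. int (c a) * a) \<in> nat_span A"
  unfolding nat_span_def by blast

lemma zero_in_nat_span: "0 \<in> nat_span A"
  using nat_spanI[of "\<lambda>_. 0" A] by simp

lemma add_in_nat_span:
  assumes "x \<in> nat_span A" "y \<in> nat_span A"
  shows "x + y \<in> nat_span A"
proof -
  from assms obtain c d where "x = (\<Sum>a\<in>A. int (c a) * a)" "y = (\<Sum>a\<in>A. int (d a) * a)"
    unfolding nat_span_def by blast
  then have "x + y = (\<Sum>a\<in>A. int (c a + d a) * a)"
    by (simp add: sum.distrib distrib_right)
  then show ?thesis using nat_spanI[of "\<lambda>a. c a + d a" A] by simp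
qed

lemma generator_in_nat_span:
  assumes "finite A" "b \<in> A"
  shows "b \<in> nat_span A"
proof -
  have "(\<Sum>a\<in>A. int (if a = b then 1 else 0) * a) = (\<Sum>a\<in>A. if a = b then a else 0)"
    by (rule sum.cong) auto
  then have "(\<Sum>a\<in>A. int (if a = b then 1 else 0) * a) = b"
    using assms by simp
  then show ?thesis using nat_spanI[of "\<lambda>a. if a = b then 1 else 0" A] by simp
qed

lemma mult_in_nat_span: "x \<in> nat_span A \<Longrightarrow> int n * x \<in> nat_span A"
  by (induction n) (auto simp: zero_in_nat_span distrib_right intro: add_in_nat_span)

lemma nat_span_least:
  assumes "0 \<in> T" "\<And>x y. x \<in> T \<Longrightarrow> y \<in> T \<Longrightarrow> x + y \<in> T" "A \<subseteq> T" "finite A"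
  shows "nat_span A \<subseteq> T"
proof
  fix s assume "s \<in> nat_span A"
  then obtain c where s: "s = (\<Sum>a\<in>A. int (c a) * a)" unfolding nat_span_def by blast
  have m: "int n * x \<in> T" if "x \<in> T" for n x
    using that by (induction n) (auto simp: assms distrib_right)
  have "B \<subseteq> A \<Longrightarrow> (\<Sum>a\<in>B. int (c a) * a) \<in> T" if "finite B" for B
    using that by (induction B rule: finite_induct) (use assms m in auto)
  then show "s \<in> T" using s \<open>finite A\<close> by blast
qed

lemma nat_span_nonneg: "\<forall>a\<in>A. a > 0 \<Longrightarrow> s \<in> nat_span A \<Longrightarrow> s \<ge> 0"
  unfolding nat_span_def by (auto intro!: sum_nonneg mult_nonneg_nonneg simp: less_imp_le)

lemma nat_span_decompose:
  assumes "finite A" "s \<in> nat_span A" "s \<noteq> 0"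
  obtains a t where "a \<in> A" "t \<in> nat_span A" "s = a + t"
proof -
  obtain c where s: "s = (\<Sum>a\<in>A. int (c a) * a)" using assms unfolding nat_span_def by blast
  have "\<exists>a\<in>A. c a \<noteq> 0"
  proof (rule ccontr)
    assume "\<not> (\<exists>a\<in>A. c a \<noteq> 0)"
    then have "s = 0" unfolding s by (intro sum.neutral) auto
    with \<open>s \<noteq> 0\<close> show False ..
  qed
  then obtain a where a: "a \<in> A" "c a \<noteq> 0" by blast
  let ?d = "c(a := c a - 1)"
  have "s = int (c a) * a + (\<Sum>x\<in>A - {a}. int (c x) * x)"
    using s a(1) assms(1) by (simp add: sum.remove)
  moreover have "(\<Sum>x\<in>A. int (?d x) * x) = int (c a - 1) * a + (\<Sum>x\<in>A - {a}. int (c x) * x)"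
    using a(1) assms(1) by (simp add: sum.remove)
  moreover have "int (c a) * a = a + int (c a - 1) * a"
    using a(2) by (simp add: of_nat_diff algebra_simps)
  ultimately have "s = a + (\<Sum>x\<in>A. int (?d x) * x)" by simp
  then show thesis using that a(1) nat_spanI[of ?d A] by blast
qed

lemma ex1_minimal_generating_set:
  assumes "numerical_semigroup S"
  shows "\<exists>!A. minimal_generating_set A S"
proof -
  obtain A where A: "generates A S"
    using assms unfolding numerical_semigroup_def by blast
  define I where "I = {s \<in> S. s \<noteq> 0 \<and> (\<forall>x\<in>S. \<forall>y\<in>S. s = x + y \<longrightarrow> x = 0 \<or> y = 0)}"
  have sub: "I \<subseteq> B" if B: "generates B S" for B
  proof
    fix s assume s: "s \<in> I"
    have fB: "finite B" and pB: "\<forall>b\<in>B. b > 0" and nB: "nat_span B = S"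
      using B by (auto simp: generates_def)
    obtain b t where bt: "b \<in> B" "t \<in> S" "s = b + t"
      using nat_span_decompose[OF fB, of s] s nB I_def by blast
    have "b \<in> S" using generator_in_nat_span[OF fB bt(1)] nB by simp
    moreover have "b \<noteq> 0" using pB bt(1) by force
    ultimately have "t = 0" using s bt unfolding I_def by blast
    then show "s \<in> B" using bt by simp
  qed
  have nonneg: "s \<ge> 0" if "s \<in> S" for s
    using A that nat_span_nonneg unfolding generates_def by blast
  have fI: "finite I" using sub[OF A] A finite_subset unfolding generates_def by blast
  have "s \<in> nat_span I" if "s \<in> S" for s
    using that
  proof (induction "nat s" arbitrary: s rule: less_induct)
    case less
    consider "s = 0" | "s \<in> I" | x y where "x \<in> S" "y \<in> S" "s = x + y" "x \<noteq> 0" "y \<noteq> 0"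
      using less.prems unfolding I_def by blast
    then show ?case
    proof cases
      case 3
      then have "x > 0" "y > 0" using nonneg[of x] nonneg[of y] by auto
      then have "x \<in> nat_span I" "y \<in> nat_span I" using 3 less.hyps[of x] less.hyps[of y] by auto
      then show ?thesis using 3 add_in_nat_span by blast
    qed (use fI zero_in_nat_span generator_in_nat_span in auto)
  qed
  moreover have "nat_span I \<subseteq> S"
    using A nat_span_least[of S I] zero_in_nat_span[of A] add_in_nat_span[of _ A] fI
    unfolding generates_def I_def by blast
  ultimately have "generates I S"
    using fI nonneg unfolding generates_def I_def by (auto simp: order_less_le)
  then show ?thesis
    using sub unfolding minimal_generating_set_def by (intro ex1I[of _ I]) blast+
qed

lemma Gcd_bezout_int:
  assumes "finite (A :: int set)"
  shows "\<exists>c. (\<Sum>a\<in>A. c a * a) = Gcd A"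
  using assms
proof (induction A rule: finite_induct)
  case (insert x A)
  then obtain c where c: "(\<Sum>a\<in>A. c a * a) = Gcd A" by blast
  obtain u v where uv: "u * x + v * Gcd A = gcd x (Gcd A)" using bezout_int by blast
  have "(\<Sum>a\<in>A. ((\<lambda>a. v * c a)(x := u)) a * a) = (\<Sum>a\<in>A. v * (c a * a))"
    using insert.hyps by (intro sum.cong) (auto simp: mult.assoc)
  then have "(\<Sum>a\<in>insert x A. ((\<lambda>a. v * c a)(x := u)) a * a) = Gcd (insert x A)"
    using insert.hyps c uv by (simp add: sum_distrib_left[symmetric])
  then show ?case by blast
qed simp

lemma numerical_semigroup_cofinite:
  assumes "numerical_semigroup S"
  shows "\<exists>N. \<forall>k\<ge>N. k \<in> S"
proof -
  obtain A where A: "finite A" "\<forall>a\<in>A. a > 0" "nat_span A = S" "Gcd A = 1"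
    using assms unfolding numerical_semigroup_def generates_def by blast
  obtain c where c: "(\<Sum>a\<in>A. c a * a) = 1" using Gcd_bezout_int[OF A(1)] A(4) by auto
  define n where "n = (\<Sum>a\<in>A. int (nat (- c a)) * a)"
  define m where "m = (\<Sum>a\<in>A. int (nat (c a)) * a)"
  have "m - n = (\<Sum>a\<in>A. c a * a)"
    unfolding m_def n_def sum_subtractf[symmetric]
    by (intro sum.cong) (auto simp: left_diff_distrib[symmetric])
  then have mn: "m = n + 1" using c by simp
  have "n \<in> S" "m \<in> S" unfolding n_def m_def A(3)[symmetric] by (rule nat_spanI)+
  then have S: "n \<in> S" "n + 1 \<in> S" using mn by simp_all
  have "n \<ge> 0" using S A nat_span_nonneg by blast
  have mult: "k * x \<in> S" if "x \<in> S" "k \<ge> 0" for k x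
    using mult_in_nat_span[of x A "nat k"] that A(3) by simp
  have "k \<in> S" if k: "k \<ge> n * n" for k
  proof (cases "n = 0")
    case True
    then show ?thesis using mult[OF S(2), of k] k by simp
  next
    case False
    with \<open>n \<ge> 0\<close> have n: "n > 0" by simp
    define q r where "q = k div n" and "r = k mod n"
    have "n \<le> q" using zdiv_mono1[OF k n] n by (simp add: q_def)
    moreover have "0 \<le> r" "r < n" using n by (auto simp: r_def)
    ultimately have "(q - r) * n + r * (n + 1) \<in> S"
      using mult[OF S(1), of "q - r"] mult[OF S(2), of r] A(3) add_in_nat_span by auto
    moreover have "k = q * n + r" by (simp add: q_def r_def)
    ultimately show ?thesis by (simp add: algebra_simps)
  qed
  then show ?thesis by blast
qed

text \<open>Hence \<open>card\<close> of an Apery set is its true number of elements.\<close>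

lemma finite_apery:
  assumes "numerical_semigroup S"
  shows "finite (apery S x)"
proof -
  obtain N where N: "\<forall>k\<ge>N. k \<in> S" using numerical_semigroup_cofinite[OF assms] by blast
  have "s \<ge> 0" if "s \<in> S" for s
    using assms that nat_span_nonneg unfolding numerical_semigroup_def generates_def by blast
  moreover have "s \<le> N + x" if "s - x \<notin> S" for s
    using N that by (smt (verit))
  ultimately have "apery S x \<subseteq> {0..N + x}"
    unfolding apery_def by auto
  then show ?thesis by (rule finite_subset) simp
qed

lemma one_in_minimal_generators:
  assumes "numerical_semigroup S" "1 \<in> S"
  shows "1 \<in> minimal_generators S"
proof -
  have "minimal_generating_set (minimal_generators S) S"
    unfolding minimal_generators_def using theI'[OF ex1_minimal_generating_set[OF assms(1)]] .
  then have M: "finite (minimal_generators S)" "\<forall>a\<in>minimal_generators S. a > 0"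
      "nat_span (minimal_generators S) = S"
    unfolding minimal_generating_set_def generates_def by auto
  obtain a t where "a \<in> minimal_generators S" "t \<in> S" "1 = a + t"
    using nat_span_decompose[OF M(1), of 1] M(3) assms(2) by auto
  moreover have "t \<ge> 0" using M nat_span_nonneg \<open>t \<in> S\<close> by blast
  moreover have "a > 0" using M calculation by blast
  ultimately have "a = 1" by linarith
  then show ?thesis using \<open>a \<in> minimal_generators S\<close> by simp
qed

lemma is_gluing_pos:
  assumes "is_gluing S a1 S1 a2 S2"
  shows "a1 > 0" "a2 > 0"
proof -
  have nn: "s \<ge> 0" if "numerical_semigroup T" "s \<in> T" for s T
    using that nat_span_nonneg unfolding numerical_semigroup_def generates_def by blast
  have *: "a1 \<ge> 0" "a2 \<ge> 0" "gcd a1 a2 = 1" using assms nn unfolding is_gluing_def by blast+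
  have "a1 \<noteq> 1" "a2 \<noteq> 1" using assms one_in_minimal_generators unfolding is_gluing_def by blast+
  then show "a1 > 0" "a2 > 0" using * by (cases "a1 = 0"; cases "a2 = 0"; simp)+
qed

lemma nat_span_mult_image: "a \<noteq> 0 \<Longrightarrow> nat_span ((*) a ` A) = a *o nat_span A"
proof -
  assume a: "a \<noteq> 0"
  have inj: "inj_on ((*) a) A" using a by (simp add: inj_on_def)
  have 1: "(\<Sum>x\<in>(*) a ` A. int (c x) * x) = a * (\<Sum>x\<in>A. int (c (a * x)) * x)" for c
    by (simp add: sum.reindex[OF inj] sum_distrib_left mult.left_commute)
  have 2: "a * (\<Sum>x\<in>A. int (c x) * x) = (\<Sum>x\<in>(*) a ` A. int (c (x div a)) * x)" for c
    unfolding 1 using a by simp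
  show ?thesis
  proof (intro equalityI subsetI)
    fix s assume "s \<in> nat_span ((*) a ` A)"
    then obtain c where "s = (\<Sum>x\<in>(*) a ` A. int (c x) * x)" unfolding nat_span_def by blast
    then show "s \<in> a *o nat_span A"
      using 1[of c] nat_spanI[of "\<lambda>x. c (a * x)" A] unfolding elt_set_times_def by blast
  next
    fix s assume "s \<in> a *o nat_span A"
    then obtain c where "s = a * (\<Sum>x\<in>A. int (c x) * x)"
      unfolding nat_span_def elt_set_times_def by blast
    then show "s \<in> nat_span ((*) a ` A)"
      using 2[of c] nat_spanI[of "\<lambda>x. c (x div a)" "(*) a ` A"] by simp
  qed
qed

lemma nat_span_Un:
  assumes "finite A" "finite B"
  shows "nat_span (A \<union> B) = nat_span A + nat_span B"
proof
  have add: "u + v \<in> nat_span A + nat_span B"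
    if u: "u \<in> nat_span A + nat_span B" and v: "v \<in> nat_span A + nat_span B" for u v
  proof -
    obtain p q where p: "u = p + q" "p \<in> nat_span A" "q \<in> nat_span B"
      using u by (rule set_plus_elim)
    obtain p' q' where q: "v = p' + q'" "p' \<in> nat_span A" "q' \<in> nat_span B"
      using v by (rule set_plus_elim)
    from p q have "(p + p') + (q + q') \<in> nat_span A + nat_span B"
      by (intro set_plus_intro add_in_nat_span)
    then show ?thesis using p(1) q(1) by (simp add: ac_simps)
  qed
  have zero: "0 \<in> nat_span A + nat_span B"
    using set_plus_intro[OF zero_in_nat_span zero_in_nat_span, of A B] by simp
  have "A \<union> B \<subseteq> nat_span A + nat_span B"
  proof
    fix x assume "x \<in> A \<union> B"
    then show "x \<in> nat_span A + nat_span B"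
      using set_plus_intro[OF generator_in_nat_span[OF assms(1), of x] zero_in_nat_span[of B]]
        set_plus_intro[OF zero_in_nat_span[of A] generator_in_nat_span[OF assms(2), of x]] by auto
  qed
  then show "nat_span (A \<union> B) \<subseteq> nat_span A + nat_span B"
    using nat_span_least[OF zero add] assms by blast
  have "nat_span A \<subseteq> nat_span (A \<union> B)" "nat_span B \<subseteq> nat_span (A \<union> B)"
    by (rule nat_span_least;
        use assms zero_in_nat_span add_in_nat_span generator_in_nat_span[of "A \<union> B"] in auto)+
  then show "nat_span A + nat_span B \<subseteq> nat_span (A \<union> B)"
    by (auto elim!: set_plus_elim intro!: add_in_nat_span)
qed

lemma is_gluing_numerical_semigroup:
  assumes "is_gluing S a1 S1 a2 S2"
  shows "numerical_semigroup S"
proof -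
  note pos = is_gluing_pos[OF assms]
  obtain A where A: "finite A" "\<forall>a\<in>A. a > 0" "nat_span A = S1" "Gcd A = 1"
    using assms unfolding is_gluing_def numerical_semigroup_def generates_def by blast
  obtain B where B: "finite B" "\<forall>a\<in>B. a > 0" "nat_span B = S2" "Gcd B = 1"
    using assms unfolding is_gluing_def numerical_semigroup_def generates_def by blast
  let ?G = "(*) a1 ` A \<union> (*) a2 ` B"
  have "nat_span ?G = S"
    using assms A B pos by (simp add: nat_span_Un nat_span_mult_image is_gluing_def)
  moreover have "Gcd ?G = 1"
  proof -
    have "Gcd ?G dvd Gcd ((*) a1 ` A)" "Gcd ?G dvd Gcd ((*) a2 ` B)"
      by (rule Gcd_greatest, rule Gcd_dvd, simp)+
    then have "Gcd ?G dvd gcd a1 a2"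
      using A(4) B(4) pos by (simp add: Gcd_mult)
    then have "is_unit (Gcd ?G)" using assms by (simp only: is_gluing_def)
    then show ?thesis by (metis normalize_Gcd normalize_1_iff)
  qed
  ultimately show ?thesis
    using A B pos unfolding numerical_semigroup_def generates_def
    by (intro exI[of _ ?G]) (auto intro: mult_pos_pos)
qed

end

theory Submission
  imports Defs
begin

text \<open>
  Every element of \<open>\<Gamma>\<close> can be written as \<open>a1 x + a2 w\<close> with \<open>x \<in> \<Gamma>1\<close> and
  \<open>w \<in> Ap(\<Gamma>2, a1)\<close>, by moving multiples of \<open>a1\<close> from the second summand into the first.
  For such \<open>w\<close> and any integer \<open>x\<close>, the number \<open>a1 x + a2 w\<close> is in \<open>\<Gamma>\<close> only if \<open>x \<in> \<Gamma>1\<close>, because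
  elements of \<open>Ap(\<Gamma>2, a1)\<close> are the least ones of \<open>\<Gamma>2\<close> in their residue classes modulo \<open>a1\<close>.
  Subtracting \<open>a1 z\<close> only changes \<open>x\<close>, which gives the equality of sets. The
  representation is unique and \<open>Ap(\<Gamma>2, a1)\<close> meets every residue class modulo \<open>a1\<close> exactly once,
  which gives the cardinality.
\<close>

lemma numerical_semigroup_add:
  "numerical_semigroup S \<Longrightarrow> x \<in> S \<Longrightarrow> y \<in> S \<Longrightarrow> x + y \<in> S"
  unfolding numerical_semigroup_def generates_def using add_in_nat_span by blast

lemma numerical_semigroup_nonneg: "numerical_semigroup S \<Longrightarrow> x \<in> S \<Longrightarrow> x \<ge> 0"
  unfolding numerical_semigroup_def generates_def using nat_span_nonneg by blast

lemma numerical_semigroup_mult: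
  assumes "numerical_semigroup S" "x \<in> S" "k \<ge> 0"
  shows "k * x \<in> S"
proof -
  obtain A where "nat_span A = S"
    using assms(1) unfolding numerical_semigroup_def generates_def by blast
  then show ?thesis using mult_in_nat_span[of x A "nat k"] assms by simp
qed

text \<open>Subtract \<open>a\<close> for as long as the result stays in \<open>S\<close>. This
  stops because \<open>S\<close> has no negative elements, and the last element reached is in the
  Apery set.\<close>

lemma apery_decompose:
  assumes S: "numerical_semigroup S" and "a > 0" "t \<in> S"
  shows "\<exists>w\<in>apery S a. \<exists>k\<ge>0. t = w + k * a"
  using \<open>t \<in> S\<close>
proof (induction "nat t" arbitrary: t rule: less_induct)
  case less
  show ?case
  proof (cases "t - a \<in> S")
    case True
    then have "nat (t - a) < nat t"
      using numerical_semigroup_nonneg[OF S True] \<open>a > 0\<close> by linarith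
    then obtain w k where "w \<in> apery S a" "k \<ge> 0" "t - a = w + k * a"
      using less.hyps True by blast
    then show ?thesis by (intro bexI[of _ w] exI[of _ "k + 1"]) (auto simp: algebra_simps)
  next
    case False
    then show ?thesis
      using less.prems by (intro bexI[of _ t] exI[of _ 0]) (auto simp: apery_def)
  qed
qed

lemma apery_least_in_class:
  assumes S: "numerical_semigroup S" and "a \<in> S" "w \<in> apery S a" "w + k * a \<in> S"
  shows "k \<ge> 0"
proof (rule ccontr)
  assume "\<not> k \<ge> 0"
  \<comment> \<open>For negative \<open>k\<close> the factor \<open>- k - 1\<close> is still
    nonnegative, and it is chosen to land on \<open>w - a\<close>, which the Apery condition
    excludes from \<open>S\<close>.\<close>
  then have "(w + k * a) + (- k - 1) * a \<in> S"
    using \<open>\<not> k \<ge> 0\<close>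
    by (intro numerical_semigroup_add[OF S assms(4)] numerical_semigroup_mult[OF S assms(2)]) simp
  moreover have "(w + k * a) + (- k - 1) * a = w - a" by (simp add: algebra_simps)
  ultimately show False using assms(3) by (simp add: apery_def)
qed

text \<open>Each of \<open>v\<close> and \<open>w\<close> is least in the common class, so
  \<open>apery_least_in_class\<close> applies in both directions and forces
  \<open>k = 0\<close>.\<close>

lemma apery_unique_in_class:
  assumes S: "numerical_semigroup S" and "a \<in> S" "v \<in> apery S a" "w \<in> apery S a"
    and "a dvd v - w"
  shows "v = w"
proof -
  obtain k where k: "v = w + k * a"
    using \<open>a dvd v - w\<close> by (metis add.commute diff_add_cancel dvdE mult.commute)
  have "k \<ge> 0"
    using apery_least_in_class[OF S \<open>a \<in> S\<close> \<open>w \<in> apery S a\<close>, of k] assms(3) k by (simp add: apery_def)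
  moreover have "- k \<ge> 0"
    using apery_least_in_class[OF S \<open>a \<in> S\<close> \<open>v \<in> apery S a\<close>, of "- k"] assms(4) k
    by (simp add: apery_def)
  ultimately show ?thesis using k by simp
qed

text \<open>Reduction modulo \<open>a\<close> is a bijection from the Apery set onto
  \<open>{0..<a}\<close>.\<close>

lemma card_apery_element:
  assumes S: "numerical_semigroup S" and "a \<in> S" "a > 0"
  shows "int (card (apery S a)) = a"
proof -
  have "inj_on (\<lambda>w. w mod a) (apery S a)"
    using apery_unique_in_class[OF S \<open>a \<in> S\<close>] by (auto simp: inj_on_def mod_eq_dvd_iff)
  moreover have "(\<lambda>w. w mod a) ` apery S a = {0..<a}"
  proof
    show "(\<lambda>w. w mod a) ` apery S a \<subseteq> {0..<a}" using \<open>a > 0\<close> by auto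
    show "{0..<a} \<subseteq> (\<lambda>w. w mod a) ` apery S a"
    proof
      fix r assume r: "r \<in> {0..<a}"
      \<comment> \<open>Every residue class meets \<open>S\<close>: shifting \<open>r\<close> by
        \<open>a\<close> times the absolute value of \<open>N\<close> keeps the class and passes the
        bound \<open>N\<close>. Descending from there reaches the Apery element.\<close>
      obtain N where N: "\<forall>k\<ge>N. k \<in> S" using numerical_semigroup_cofinite[OF S] by blast
      have "\<bar>N\<bar> * 1 \<le> \<bar>N\<bar> * a" using \<open>a > 0\<close> by (intro mult_left_mono) auto
      then have "r + \<bar>N\<bar> * a \<in> S" using r N by auto
      then obtain w k where w: "w \<in> apery S a" "r + \<bar>N\<bar> * a = w + k * a"
        using apery_decompose[OF S \<open>a > 0\<close>] by blast
      have "r = (r + \<bar>N\<bar> * a) mod a" using r by simp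
      also have "\<dots> = w mod a" by (simp add: w(2))
      finally show "r \<in> (\<lambda>w. w mod a) ` apery S a" using w(1) by blast
    qed
  qed
  ultimately have "card (apery S a) = card {0..<a}" by (metis card_image)
  then show ?thesis using \<open>a > 0\<close> by simp
qed

text \<open>The transfer is \<open>a2 * (w + k * a1) = a1 * (k * a2) + a2 * w\<close>, where
  \<open>k * a2\<close> is in \<open>S1\<close> because \<open>a2\<close> is.\<close>

lemma gluing_decompose:
  assumes G: "is_gluing S a1 S1 a2 S2" and "g \<in> S"
  obtains x w where "x \<in> S1" "w \<in> apery S2 a1" "g = a1 * x + a2 * w"
proof -
  obtain s t where st: "s \<in> S1" "t \<in> S2" "g = a1 * s + a2 * t"
    using assms by (auto simp: is_gluing_def elt_set_times_def elim!: set_plus_elim)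
  have S: "numerical_semigroup S1" "numerical_semigroup S2" "a2 \<in> S1"
    using G by (auto simp: is_gluing_def)
  obtain w k where w: "w \<in> apery S2 a1" "k \<ge> 0" "t = w + k * a1"
    using apery_decompose[OF S(2) is_gluing_pos(1)[OF G] st(2)] by blast
  have "s + k * a2 \<in> S1"
    using S st w by (intro numerical_semigroup_add numerical_semigroup_mult)
  moreover have "g = a1 * (s + k * a2) + a2 * w" using st w by (simp add: algebra_simps)
  ultimately show thesis using that w by blast
qed

lemma gluing_member_iff:
  assumes G: "is_gluing S a1 S1 a2 S2" and w: "w \<in> apery S2 a1"
  shows "a1 * x + a2 * w \<in> S \<longleftrightarrow> x \<in> S1"
proof
  assume "x \<in> S1"
  then show "a1 * x + a2 * w \<in> S"
    using G w unfolding is_gluing_def apery_def elt_set_times_def by (auto intro!: set_plus_intro)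
next
  assume "a1 * x + a2 * w \<in> S"
  then obtain s t where st: "s \<in> S1" "t \<in> S2" "a1 * x + a2 * w = a1 * s + a2 * t"
    using G by (auto simp: is_gluing_def elt_set_times_def elim!: set_plus_elim)
  have S: "numerical_semigroup S1" "numerical_semigroup S2" "a1 \<in> S2" "a2 \<in> S1" "coprime a1 a2"
    using G by (auto simp: is_gluing_def coprime_iff_gcd_eq_1)
  \<comment> \<open>Coprimality puts \<open>t\<close> and \<open>w\<close> in the same class modulo
    \<open>a1\<close>, so minimality of \<open>w\<close> makes \<open>k\<close> nonnegative, and
    cancelling \<open>a1\<close> exhibits \<open>x\<close> as an element of
    \<open>S1\<close>.\<close>
  have "a2 * (t - w) = a1 * (x - s)" using st by (simp add: algebra_simps)
  then have "a1 dvd t - w" using S(5) by (metis coprime_dvd_mult_right_iff dvd_triv_left)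
  then obtain k where k: "t = w + k * a1"
    by (metis add.commute diff_add_cancel dvdE mult.commute)
  have "k \<ge> 0" using apery_least_in_class[OF S(2,3) w, of k] st k by simp
  have "a1 * x = a1 * (s + k * a2)" using st k by (simp add: algebra_simps)
  then have "x = s + k * a2" using is_gluing_pos(1)[OF G] by simp
  then show "x \<in> S1"
    using S st \<open>k \<ge> 0\<close> by (auto intro!: numerical_semigroup_add numerical_semigroup_mult)
qed

text \<open>Modulo \<open>a1\<close> the value determines the class of \<open>w\<close>, hence
  \<open>w\<close> itself, and then \<open>x\<close>.\<close>

lemma gluing_representation_inj:
  assumes G: "is_gluing S a1 S1 a2 S2"
  shows "inj_on (\<lambda>(x, w). a1 * x + a2 * w) (X \<times> apery S2 a1)"
proof (rule inj_onI, clarify)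
  fix x w y v
  assume w: "w \<in> apery S2 a1" "v \<in> apery S2 a1" and eq: "a1 * x + a2 * w = a1 * y + a2 * v"
  have S: "numerical_semigroup S2" "a1 \<in> S2" "coprime a1 a2"
    using G by (auto simp: is_gluing_def coprime_iff_gcd_eq_1)
  have "a2 * (w - v) = a1 * (y - x)" using eq by (simp add: algebra_simps)
  then have "a1 dvd w - v" using S(3) by (metis coprime_dvd_mult_right_iff dvd_triv_left)
  then have "w = v" using apery_unique_in_class[OF S(1,2)] w by blast
  then show "x = y \<and> w = v" using eq is_gluing_pos(1)[OF G] by simp
qed

lemma set_plus_elt_times_image:
  "a *o X + b *o Y = (\<lambda>(x, y). a * x + b * y) ` (X \<times> Y)"
  by (force simp: elt_set_times_def set_plus_def)

lemma apery_gluing: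
  assumes G: "is_gluing S a1 S1 a2 S2"
  shows "apery S (a1 * z) = a1 *o apery S1 z + a2 *o apery S2 a1"
proof -
  have iff: "a1 * x + a2 * w \<in> apery S (a1 * z) \<longleftrightarrow> x \<in> apery S1 z" if "w \<in> apery S2 a1" for x w
  proof -
    \<comment> \<open>The shifted element has the same \<open>w\<close>, so
      \<open>gluing_member_iff\<close> decides both conditions of the Apery set, at \<open>x\<close>
      and at \<open>x - z\<close>.\<close>
    have "a1 * x + a2 * w - a1 * z = a1 * (x - z) + a2 * w" by (simp add: algebra_simps)
    then show ?thesis by (simp only: apery_def mem_Collect_eq gluing_member_iff[OF G that])
  qed
  show ?thesis
    unfolding set_plus_elt_times_image
  proof (intro equalityI subsetI)
    fix g assume g: "g \<in> apery S (a1 * z)"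
    then have "g \<in> S" by (simp add: apery_def)
    then obtain x w where "w \<in> apery S2 a1" "g = a1 * x + a2 * w"
      by (rule gluing_decompose[OF G])
    then show "g \<in> (\<lambda>(x, w). a1 * x + a2 * w) ` (apery S1 z \<times> apery S2 a1)"
      using iff g by force
  qed (use iff in auto)
qed

theorem proposition10:
  fixes \<Gamma> \<Gamma>1 \<Gamma>2 :: "int set" and a1 a2 :: int
  assumes "is_gluing \<Gamma> a1 \<Gamma>1 a2 \<Gamma>2"
  shows "\<forall>z :: int.
    apery \<Gamma> (a1 * z) = a1 *o apery \<Gamma>1 z + a2 *o apery \<Gamma>2 a1 \<and>
    int (card (apery \<Gamma> (a1 * z))) = a1 * int (card (apery \<Gamma>1 z))"
proof (intro allI conjI)
  fix z
  show eq: "apery \<Gamma> (a1 * z) = a1 *o apery \<Gamma>1 z + a2 *o apery \<Gamma>2 a1"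
    by (rule apery_gluing[OF assms])
  have "card (apery \<Gamma> (a1 * z)) = card (apery \<Gamma>1 z) * card (apery \<Gamma>2 a1)"
    unfolding eq set_plus_elt_times_image
    by (simp add: card_image[OF gluing_representation_inj[OF assms]] card_cartesian_product)
  moreover have "int (card (apery \<Gamma>2 a1)) = a1"
    using assms is_gluing_pos(1)[OF assms] by (intro card_apery_element) (auto simp: is_gluing_def)
  ultimately show "int (card (apery \<Gamma> (a1 * z))) = a1 * int (card (apery \<Gamma>1 z))"
    by simp
qed

end
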